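(* Let $k$ be a field of characteristic $p>0$, let $f\in k[x,y,z]$ be a nonzero homogeneous polynomial of degree $d$ with $f\in(x,y,z)^2$, and let $R=k[x,y,z]/(f)$. Suppose that $p$ and $d$ are of opposite parity. If $f$ is $q$-link-compressed for some power $q$ of $p$ with $q\ge d+3$, then $$HK(q)=\frac34\,d\,q^2-\frac1{12}(d^3-d).$$
   Context: $HK(q)=HK_R(q)=\dim_kR/\mathfrak m^{[q]}$, with $\mathfrak m$ the homogeneous maximal ideal of $R$ and $\mathfrak m^{[q]}=(x^q,y^q,z^q)R$. Put $P=k[x,y,z]$ and, for a graded $k$-algebra $B$, $H_i(B)=\dim_kB_i$. For a homogeneous complete intersection ideal $\mathfrak c\subseteq P$ with $P/\mathfrak c$ Artinian and a homogeneous Gorenstein ideal $J\supseteq\mathfrak c$ with $P/J$ of socle degree $s$, $J$ is $\mathfrak c$-compressed if $H_i(P/J)=\min\{H_i(P/\mathfrak c),H_{s-i}(P/\mathfrak c)\}$ for every $i$. $f$ is $q$-link-compressed if $((x^q,y^q,z^q):_Pf)$ is $(x^q,y^q,z^q)$-compressed. *)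

theory Defs
  imports "HOL-Algebra.Algebra" "HOL-Algebra.Algebraic_Closure_Type" "HOL-Library.Poly_Mapping"
begin

section \<open>The polynomial ring \<open>P = k[x,y,z]\<close>\<close>

datatype var = VX | VY | VZ

type_synonym 'k poly3 = "(var \<Rightarrow>\<^sub>0 nat) \<Rightarrow>\<^sub>0 'k"

abbreviation P3 :: "('k::field) poly3 ring" where
  "P3 \<equiv> ring_of_type_algebra"

definition Const3 :: "'k::field \<Rightarrow> 'k poly3" where
  "Const3 a = Poly_Mapping.single 0 a"

definition Var3 :: "var \<Rightarrow> ('k::field) poly3" where
  "Var3 v = Poly_Mapping.single (Poly_Mapping.single v 1) 1"

definition mdeg :: "(var \<Rightarrow>\<^sub>0 nat) \<Rightarrow> nat" where
  "mdeg m = (\<Sum>v\<in>Poly_Mapping.keys m. Poly_Mapping.lookup m v)"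

text \<open>The graded piece \<open>P\<^sub>i\<close>, including the zero form. The degree is an integer, so that
  \<open>P\<^sub>i = 0\<close> for \<open>i < 0\<close> and expressions such as \<open>H\<^bsub>s-i\<^esub>\<close> make sense for every \<open>i\<close>.\<close>
definition forms :: "int \<Rightarrow> ('k::field) poly3 set" where
  "forms i = {g. \<forall>m\<in>Poly_Mapping.keys g. int (mdeg m) = i}"

definition irrelevant_ideal :: "('k::field) poly3 set" where
  "irrelevant_ideal = Idl\<^bsub>P3\<^esub> (range Var3)"

definition homogeneous_ideal :: "('k::field) poly3 set \<Rightarrow> bool" where
  "homogeneous_ideal J \<longleftrightarrow> (\<exists>S. S \<subseteq> (\<Union>i. forms i) \<and> J = Idl\<^bsub>P3\<^esub> S)"


section \<open>Quotients \<open>P/J\<close> as graded \<open>k\<close>-algebras\<close>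

abbreviation coset3 :: "('k::field) poly3 set \<Rightarrow> 'k poly3 \<Rightarrow> 'k poly3 set" where
  "coset3 J g \<equiv> J +>\<^bsub>P3\<^esub> g"

text \<open>For a subspace \<open>V\<close> of \<open>P/J\<close>; the ground field is the image of \<open>k\<close> in \<open>P/J\<close>.\<close>
definition quot_dimension :: "('k::field) poly3 set \<Rightarrow> nat \<Rightarrow> 'k poly3 set set \<Rightarrow> bool" where
  "quot_dimension J n V \<longleftrightarrow> ring.dimension (P3 Quot J) n (range (\<lambda>a. coset3 J (Const3 a))) V"

definition graded_piece :: "('k::field) poly3 set \<Rightarrow> int \<Rightarrow> 'k poly3 set set" where
  "graded_piece J i = coset3 J ` forms i"

definition hilbert_fun :: "('k::field) poly3 set \<Rightarrow> int \<Rightarrow> nat" where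
  "hilbert_fun J i =
     (ring.dim (P3 Quot J) over range (\<lambda>a. coset3 J (Const3 a))) (graded_piece J i)"

definition artinian :: "('a, 'b) ring_scheme \<Rightarrow> bool" where
  "artinian A \<longleftrightarrow>
     (\<forall>I :: nat \<Rightarrow> 'a set. (\<forall>n. ideal (I n) A \<and> I (Suc n) \<subseteq> I n) \<longrightarrow> (\<exists>n. \<forall>m\<ge>n. I m = I n))"


section \<open>Gorenstein ideals, complete intersections and compressedness\<close>

definition quot_socle :: "('k::field) poly3 set \<Rightarrow> 'k poly3 set set" where
  "quot_socle J = {u \<in> carrier (P3 Quot J).
     \<forall>g\<in>irrelevant_ideal. coset3 J g \<otimes>\<^bsub>P3 Quot J\<^esub> u = \<zero>\<^bsub>P3 Quot J\<^esub>}"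

text \<open>Only ideals of finite colength occur here; for these, \<open>P/J\<close> is Gorenstein iff it is Artinian
  with one-dimensional socle.\<close>
definition gorenstein_ideal :: "('k::field) poly3 set \<Rightarrow> bool" where
  "gorenstein_ideal J \<longleftrightarrow>
     homogeneous_ideal J \<and> artinian (P3 Quot J) \<and> quot_dimension J 1 (quot_socle J)"

text \<open>The degree in which the (one-dimensional, graded) socle of \<open>P/J\<close> lives.\<close>
definition socle_degree :: "('k::field) poly3 set \<Rightarrow> int \<Rightarrow> bool" where
  "socle_degree J s \<longleftrightarrow> quot_dimension J 1 (quot_socle J) \<and> quot_socle J \<subseteq> graded_piece J s"

definition regular_sequence :: "('k::field) poly3 list \<Rightarrow> bool" where
  "regular_sequence gs \<longleftrightarrow>
     (\<forall>i<length gs. \<forall>h. h * gs ! i \<in> Idl\<^bsub>P3\<^esub> (set (take i gs)) \<longrightarrow> h \<in> Idl\<^bsub>P3\<^esub> (set (take i gs))) \<and>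
     Idl\<^bsub>P3\<^esub> (set gs) \<noteq> carrier P3"

definition homogeneous_ci :: "('k::field) poly3 set \<Rightarrow> bool" where
  "homogeneous_ci c \<longleftrightarrow>
     (\<exists>gs. set gs \<subseteq> (\<Union>i. forms i) \<and> regular_sequence gs \<and> c = Idl\<^bsub>P3\<^esub> (set gs))"

definition compressed :: "('k::field) poly3 set \<Rightarrow> 'k poly3 set \<Rightarrow> bool" where
  "compressed c J \<longleftrightarrow>
     homogeneous_ci c \<and> artinian (P3 Quot c) \<and> gorenstein_ideal J \<and> c \<subseteq> J \<and>
     (\<exists>s. socle_degree J s \<and>
        (\<forall>i. hilbert_fun J i = min (hilbert_fun c i) (hilbert_fun c (s - i))))"

definition frobenius_ci :: "nat \<Rightarrow> ('k::field) poly3 set" where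
  "frobenius_ci q = Idl\<^bsub>P3\<^esub> (range (\<lambda>v. Var3 v ^ q))"

definition colon_ideal :: "('k::field) poly3 set \<Rightarrow> 'k poly3 \<Rightarrow> 'k poly3 set" where
  "colon_ideal c f = {g. g * f \<in> c}"

definition link_compressed :: "nat \<Rightarrow> ('k::field) poly3 \<Rightarrow> bool" where
  "link_compressed q f \<longleftrightarrow> compressed (frobenius_ci q) (colon_ideal (frobenius_ci q) f)"


section \<open>The Hilbert-Kunz function of \<open>R = P/(f)\<close>\<close>

definition hypersurface :: "('k::field) poly3 \<Rightarrow> 'k poly3 set ring" where
  "hypersurface f = P3 Quot (PIdl\<^bsub>P3\<^esub> f)"

definition frobenius_power :: "('k::field) poly3 \<Rightarrow> nat \<Rightarrow> 'k poly3 set set" where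
  "frobenius_power f q =
     Idl\<^bsub>hypersurface f\<^esub> (range (\<lambda>v. coset3 (PIdl\<^bsub>P3\<^esub> f) (Var3 v) [^]\<^bsub>hypersurface f\<^esub> q))"

definition HK :: "('k::field) poly3 \<Rightarrow> nat \<Rightarrow> nat" where
  "HK f q =
     (let A = hypersurface f Quot frobenius_power f q;
          K = range (\<lambda>a. frobenius_power f q +>\<^bsub>hypersurface f\<^esub> coset3 (PIdl\<^bsub>P3\<^esub> f) (Const3 a))
      in (ring.dim A over K) (carrier A))"

end

theory Submission
  imports Defs
begin

text \<open>
  Let \<open>c = (x\<^sup>q, y\<^sup>q, z\<^sup>q)\<close>. The monomials with all exponents below \<open>q\<close> form a basis of \<open>P/c\<close>, and
  multiplication by \<open>f\<close> on \<open>P/c\<close> has kernel \<open>(c : f)/c\<close> and cokernel \<open>P/(c + f P)\<close>. Hence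
  \<open>HK(q) = q\<^sup>3 - dim P/(c : f)\<close>. The socle of \<open>P/(c : f)\<close> lies in degree \<open>s = 3(q - 1) - d\<close>, which is
  even by the parity hypothesis, so compressedness gives \<open>dim P/(c : f)\<close> as the sum over
  \<open>0 \<le> i \<le> s\<close> of \<open>min (h i) (h (s - i))\<close>, where \<open>h\<close> is the Hilbert function of \<open>P/c\<close>.
  Since \<open>h\<close> is symmetric and unimodal, only its values in degrees up to \<open>s/2 < 2q\<close> matter, where it
  is explicitly quadratic on each side of \<open>q\<close>.
\<close>

section \<open>Counting monomials\<close>

text \<open>The length of the integer interval of admissible first entries \<open>b\<close>, with
  \<open>c = j - b\<close> determined by it. The outer \<open>max 0\<close> covers those
  \<open>j\<close> for which the interval is empty. As a function of \<open>j\<close> this is a tent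
  with peak at \<open>q - 1\<close>.\<close>

definition pairs_count :: "int \<Rightarrow> int \<Rightarrow> int" where
  "pairs_count q j = max 0 (min (q - 1) j - max 0 (j - q + 1) + 1)"

text \<open>The Hilbert function of k[x,y,z]/(x^q,y^q,z^q) in degree \<open>i\<close>, summed over
  the exponent \<open>a\<close> of x.\<close>

definition triples_count :: "nat \<Rightarrow> int \<Rightarrow> int" where
  "triples_count q i = (\<Sum>a<q. pairs_count (int q) (i - int a))"

lemma card_pairs:
  "int (card {(b, c). b < q \<and> c < q \<and> int b + int c = j}) = pairs_count (int q) j"
proof -
  have "bij_betw (\<lambda>b. (nat b, nat (j - b))) {max 0 (j - int q + 1)..min (int q - 1) j}
      {(b, c). b < q \<and> c < q \<and> int b + int c = j}"
    by (rule bij_betwI[where g = "\<lambda>(b, c). int b"]) auto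
  from bij_betw_same_card[OF this]
  have "card {(b, c). b < q \<and> c < q \<and> int b + int c = j}
      = card {max 0 (j - int q + 1)..min (int q - 1) j}" by simp
  then show ?thesis
    by (simp add: pairs_count_def)
qed

lemma card_triples:
  "int (card {(a, b, c). a < q \<and> b < q \<and> c < q \<and> int a + int b + int c = i})
    = triples_count q i"
proof -
  let ?S = "\<lambda>a. {(b, c). b < q \<and> c < q \<and> int b + int c = i - int a}"
  have fin: "finite (?S a)" for a
    by (rule finite_subset[of _ "{..<q} \<times> {..<q}"]) auto
  have "{(a, b, c). a < q \<and> b < q \<and> c < q \<and> int a + int b + int c = i}
      = (SIGMA a:{..<q}. ?S a)"
    by auto
  then have "card {(a, b, c). a < q \<and> b < q \<and> c < q \<and> int a + int b + int c = i}
      = (\<Sum>a<q. card (?S a))"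
    using fin by simp
  then show ?thesis
    by (simp add: triples_count_def card_pairs)
qed

lemma triples_count_eq_0: "i < 0 \<Longrightarrow> triples_count q i = 0"
  by (auto simp: triples_count_def pairs_count_def intro!: sum.neutral)

text \<open>Both sides are sums of \<open>pairs_count\<close> over windows of q consecutive
  arguments, and the windows differ by a shift of one, so only the two end terms survive. For the
  induction the number \<open>n\<close> of summands is separated from the box size
  \<open>q\<close>.\<close>

lemma triples_count_step:
  "triples_count q (i + 1) - triples_count q i
    = pairs_count (int q) (i + 1) - pairs_count (int q) (i + 1 - int q)"
proof -
  have "(\<Sum>a<n. pairs_count (int q) (i + 1 - int a)) - (\<Sum>a<n. pairs_count (int q) (i - int a))
      = pairs_count (int q) (i + 1) - pairs_count (int q) (i + 1 - int n)" for n
    by (induction n) (auto simp: algebra_simps)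
  from this[of q] show ?thesis
    by (simp add: triples_count_def)
qed

text \<open>Reversing the summation by \<open>a\<close> -> \<open>q - 1 - a\<close> reduces this to
  the symmetry of the tent \<open>pairs_count\<close> under \<open>j\<close> ->
  \<open>2 * (q - 1) - j\<close>.\<close>

lemma triples_count_symmetric: "triples_count q (3 * (int q - 1) - i) = triples_count q i"
proof -
  have "triples_count q (3 * (int q - 1) - i)
      = (\<Sum>a<q. pairs_count (int q) (3 * (int q - 1) - i - int (q - Suc a)))"
    unfolding triples_count_def by (rule sum.nat_diff_reindex[symmetric])
  also have "\<dots> = (\<Sum>a<q. pairs_count (int q) (i - int a))"
    by (rule sum.cong) (auto simp: pairs_count_def of_nat_diff)
  finally show ?thesis
    by (simp add: triples_count_def)
qed

text \<open>The increment compares the tent at \<open>i + 1\<close> and at \<open>i + 1 - q\<close>.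
  The assumption says that the midpoint of these arguments is at most the peak \<open>q - 1\<close>,
  so the larger argument is at least as close to the peak.\<close>

lemma triples_count_le_Suc:
  assumes "2 * i + 1 \<le> 3 * (int q - 1)"
  shows "triples_count q i \<le> triples_count q (i + 1)"
proof -
  have "pairs_count (int q) (i + 1 - int q) \<le> pairs_count (int q) (i + 1)"
    using assms by (auto simp: pairs_count_def)
  then show ?thesis
    using triples_count_step[of q i] by linarith
qed

text \<open>The assumptions say that \<open>j\<close> is at least as close to the centre
  \<open>3 * (q - 1) / 2\<close> as \<open>i\<close> is. If \<open>j\<close> lies beyond the centre,
  it is first reflected to the left half.\<close>

lemma triples_count_mono:
  assumes "i \<le> j" "i + j \<le> 3 * (int q - 1)"
  shows "triples_count q i \<le> triples_count q j"
proof -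
  have up: "triples_count q i \<le> triples_count q j'"
    if "i \<le> j'" "2 * j' \<le> 3 * (int q - 1)" for j'
    using that
  proof (induction j' rule: int_ge_induct)
    case (step j')
    then show ?case
      using triples_count_le_Suc[of j' q] by force
  qed simp
  show ?thesis
  proof (cases "2 * j \<le> 3 * (int q - 1)")
    case True
    then show ?thesis using up assms by blast
  next
    case False
    then show ?thesis
      using up[of "3 * (int q - 1) - j"] assms triples_count_symmetric[of q j] by force
  qed
qed

text \<open>Inclusion-exclusion: from all monomials of degree n, those with a given exponent at
  least q are removed, once for each variable. Since \<open>n < 2 * q\<close>, no two exponents can
  both reach q, so there are no further terms. The factor 2 clears the binomial
  denominators.\<close>

lemma triples_count_eq:
  assumes "n < 2 * q"
  shows "2 * triples_count q (int n) = (int n + 1) * (int n + 2)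
      - (if q \<le> n then 3 * (int n - int q + 1) * (int n - int q + 2) else 0)"
  using assms
proof (induction n)
  case 0
  then show ?case
    using triples_count_step[of q "-1"] triples_count_eq_0[of "-1" q]
    by (simp add: pairs_count_def)
next
  case (Suc n)
  have st: "triples_count q (int (Suc n)) = triples_count q (int n)
     + (pairs_count (int q) (int n + 1) - pairs_count (int q) (int n + 1 - int q))"
    using triples_count_step[of q "int n"] by (simp add: algebra_simps)
  \<comment> \<open>The middle case is the only one in which the correction term is absent at
    \<open>n\<close> and present at \<open>Suc n\<close>.\<close>
  consider "Suc n < q" | "Suc n = q" | "q \<le> n" by linarith
  then show ?case
  proof cases
    case 1
    then have "pairs_count (int q) (int n + 1) - pairs_count (int q) (int n + 1 - int q) = int n + 2"
      by (simp add: pairs_count_def)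
    with st 1 Suc show ?thesis by (simp add: algebra_simps)
  next
    case 2
    then have q: "int q = int n + 1" by simp
    have "pairs_count (int q) (int n + 1) - pairs_count (int q) (int n + 1 - int q) = int n - 1"
      unfolding q pairs_count_def by simp
    with st 2 Suc show ?thesis by (simp add: q algebra_simps)
  next
    case 3
    then have "pairs_count (int q) (int n + 1) - pairs_count (int q) (int n + 1 - int q)
        = (2 * int q - 2 - int n) - (int n + 2 - int q)"
      using Suc.prems by (simp add: pairs_count_def)
    with st 3 Suc show ?thesis by (simp add: algebra_simps)
  qed
qed

text \<open>Summing the two binomial terms of the previous formula by the hockey-stick identity; the
  factor 6 clears denominators.\<close>

lemma sum_triples_count_eq:
  assumes "n \<le> 2 * q"
  shows "6 * (\<Sum>i<n. triples_count q (int i)) = int n * (int n + 1) * (int n + 2)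
      - (if q \<le> n then 3 * (int n - int q) * (int n - int q + 1) * (int n - int q + 2) else 0)"
  using assms
proof (induction n)
  case (Suc n)
  consider "Suc n < q" | "Suc n = q" | "q \<le> n" by linarith
  then show ?case
  proof cases
    case 2
    then have q: "int q = int n + 1" by simp
    with 2 Suc triples_count_eq[of n q] show ?thesis by (simp add: algebra_simps)
  qed (use Suc triples_count_eq[of n q] in \<open>simp_all add: algebra_simps\<close>)
qed simp

text \<open>Here \<open>2 * t\<close> is the socle degree \<open>3 * (q - 1) - d\<close>, and the
  sum is the dimension of P/(c : f). The minimum is the Hilbert function itself up to the middle
  degree \<open>t\<close> and its mirror image beyond.\<close>

lemma sum_min_triples_count:
  assumes "int q * 3 = 2 * int t + int d + 3" "d + 3 \<le> q"
  shows "12 * (int q ^ 3 - (\<Sum>i\<in>{0..2 * int t}. min (triples_count q i) (triples_count q (2 * int t - i))))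
    = 9 * int d * int q ^ 2 - (int d ^ 3 - int d)"
proof -
  let ?h = "triples_count q"
  let ?m = "\<lambda>i. min (?h i) (?h (2 * int t - i))"
  \<comment> \<open>The two degrees \<open>i\<close> and \<open>2 * t - i\<close> add up to
    \<open>3 * (q - 1) - d\<close>, so monotonicity towards the centre applies.\<close>
  have min_eq: "?m i = ?h i" if "i \<le> int t" for i
    using triples_count_mono[of i "2 * int t - i" q] that assms by (simp add: min_def)
  have "(\<Sum>i\<in>{0..2 * int t}. ?m i) = (\<Sum>i<Suc (2 * t). ?m (int i))"
    by (rule sum.reindex_bij_witness[of _ int nat]) auto
  also have "{..<Suc (2 * t)} = {..<t} \<union> {t} \<union> {t<..2 * t}"
    by auto
  also have "(\<Sum>i\<in>{..<t} \<union> {t} \<union> {t<..2 * t}. ?m (int i))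
      = (\<Sum>i<t. ?m (int i)) + ?m (int t) + (\<Sum>i\<in>{t<..2 * t}. ?m (int i))"
    by (subst sum.union_disjoint; (subst sum.union_disjoint)?) auto
  \<comment> \<open>The reflection \<open>i\<close> -> \<open>2 * t - i\<close> only swaps the two
    arguments of the minimum.\<close>
  also have "(\<Sum>i\<in>{t<..2 * t}. ?m (int i)) = (\<Sum>i<t. ?m (int i))"
    by (rule sum.reindex_bij_witness[of _ "\<lambda>i. 2 * t - i" "\<lambda>i. 2 * t - i"])
       (auto simp: of_nat_diff min.commute)
  also have "(\<Sum>i<t. ?m (int i)) = (\<Sum>i<t. ?h (int i))"
    by (rule sum.cong) (use min_eq in auto)
  finally have sum_eq: "(\<Sum>i\<in>{0..2 * int t}. ?m i) = 2 * (\<Sum>i<t. ?h (int i)) + ?h (int t)"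
    using min_eq by simp
  \<comment> \<open>At \<open>q = Suc t\<close> the correction terms vanish through the factor
    \<open>int t - int q + 1\<close>. Hence on the whole range \<open>q \<le> Suc t\<close> the
    formulas \<open>G\<close> and \<open>H\<close> hold without a case distinction.\<close>
  have range: "q \<le> Suc t" "t < 2 * q" using assms by linarith+
  \<comment> \<open>Eliminating \<open>d\<close> turns the final claim into a polynomial identity in
    \<open>q\<close> and \<open>t\<close>.\<close>
  have d: "int d = 3 * int q - 3 - 2 * int t" using assms(1) by linarith
  have G: "6 * (\<Sum>i<t. ?h (int i)) = int t * (int t + 1) * (int t + 2)
      - 3 * (int t - int q) * (int t - int q + 1) * (int t - int q + 2)"
  proof (cases "q \<le> t")
    case False
    then have q: "int q = int t + 1" using range by simp
    show ?thesis
      using sum_triples_count_eq[of t q] range False by (simp add: q)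
  qed (use sum_triples_count_eq[of t q] range in simp)
  have H: "2 * ?h (int t) = (int t + 1) * (int t + 2)
      - 3 * (int t - int q + 1) * (int t - int q + 2)"
  proof (cases "q \<le> t")
    case False
    then have q: "int q = int t + 1" using range by simp
    show ?thesis
      using triples_count_eq[of t q] range False by (simp add: q)
  qed (use triples_count_eq[of t q] range in simp)
  have "12 * (int q ^ 3 - (2 * (\<Sum>i<t. ?h (int i)) + ?h (int t)))
      = 12 * int q ^ 3 - 4 * (6 * (\<Sum>i<t. ?h (int i))) - 6 * (2 * ?h (int t))"
    by (simp add: algebra_simps)
  also have "\<dots> = 9 * int d * int q ^ 2 - (int d ^ 3 - int d)"
    unfolding G H d by (simp add: algebra_simps power2_eq_square power3_eq_cube)
  finally show ?thesis
    unfolding sum_eq .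
qed

section \<open>Exponent vectors and the box of exponents below q\<close>

abbreviation lookup where "lookup \<equiv> Poly_Mapping.lookup"
abbreviation keys where "keys \<equiv> Poly_Mapping.keys"

text \<open>The exponent vectors of the monomials outside (x^q, y^q, z^q).\<close>

definition small :: "nat \<Rightarrow> (var \<Rightarrow>\<^sub>0 nat) set" where
  "small q = {m. \<forall>v. lookup m v < q}"

definition monom3 :: "nat \<Rightarrow> nat \<Rightarrow> nat \<Rightarrow> (var \<Rightarrow>\<^sub>0 nat)" where
  "monom3 a b c = Poly_Mapping.single VX a + Poly_Mapping.single VY b + Poly_Mapping.single VZ c"

text \<open>The linear projection of P onto the span of the small monomials along (x^q, y^q, z^q).
  It picks a canonical representative of each class, so that computations in P/c take place inside
  P.\<close>

definition reduce :: "nat \<Rightarrow> ('k::field) poly3 \<Rightarrow> 'k poly3" where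
  "reduce q g = (\<Sum>m\<in>keys g \<inter> small q. Poly_Mapping.single m (lookup g m))"

lemma UNIV_var: "(UNIV :: var set) = {VX, VY, VZ}"
  using var.exhaust by auto

lemma lookup_monom3 [simp]:
  "lookup (monom3 a b c) VX = a" "lookup (monom3 a b c) VY = b" "lookup (monom3 a b c) VZ = c"
  by (simp_all add: monom3_def lookup_add lookup_single when_def)

lemma monom3_lookup [simp]: "monom3 (lookup m VX) (lookup m VY) (lookup m VZ) = m"
proof (rule poly_mapping_eqI)
  fix v
  show "lookup (monom3 (lookup m VX) (lookup m VY) (lookup m VZ)) v = lookup m v"
    by (cases v) simp_all
qed

lemma mdeg_eq: "mdeg m = lookup m VX + lookup m VY + lookup m VZ"
proof -
  have "finite (UNIV :: var set)"
    by (simp add: UNIV_var)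
  then have "mdeg m = (\<Sum>v\<in>UNIV. lookup m v)"
    unfolding mdeg_def
    by (rule sum.mono_neutral_left) (auto simp: in_keys_iff)
  then show ?thesis
    by (simp add: UNIV_var)
qed

lemma mdeg_add: "mdeg (m + n) = mdeg m + mdeg n"
  by (simp add: mdeg_eq lookup_add)

lemma small_iff: "m \<in> small q \<longleftrightarrow> lookup m VX < q \<and> lookup m VY < q \<and> lookup m VZ < q"
proof -
  have "(\<forall>v\<in>UNIV. lookup m v < q) \<longleftrightarrow> lookup m VX < q \<and> lookup m VY < q \<and> lookup m VZ < q"
    unfolding UNIV_var by simp
  then show ?thesis by (simp add: small_def)
qed

lemma mdeg_small: "m \<in> small q \<Longrightarrow> int (mdeg m) \<le> 3 * (int q - 1)"
  by (simp add: small_iff mdeg_eq)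

lemma card_small_mdeg: "int (card {m \<in> small q. int (mdeg m) = i}) = triples_count q i"
proof -
  have "bij_betw (\<lambda>(a, b, c). monom3 a b c)
      {(a, b, c). a < q \<and> b < q \<and> c < q \<and> int a + int b + int c = i}
      {m \<in> small q. int (mdeg m) = i}"
    by (rule bij_betwI[where g = "\<lambda>m. (lookup m VX, lookup m VY, lookup m VZ)"])
       (auto simp: small_iff mdeg_eq)
  from bij_betw_same_card[OF this] card_triples[of q i] show ?thesis
    by simp
qed

lemma card_small: "finite (small q)" "card (small q) = q ^ 3"
proof -
  have bij: "bij_betw (\<lambda>(a, b, c). monom3 a b c) ({..<q} \<times> {..<q} \<times> {..<q}) (small q)"
    by (rule bij_betwI[where g = "\<lambda>m. (lookup m VX, lookup m VY, lookup m VZ)"])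
       (auto simp: small_iff)
  show "finite (small q)"
    using bij_betw_finite[OF bij] by blast
  show "card (small q) = q ^ 3"
    using bij_betw_same_card[OF bij] by (simp add: power3_eq_cube)
qed

section \<open>Polynomials modulo \<open>(x\<^sup>q, y\<^sup>q, z\<^sup>q)\<close>\<close>

interpretation P3: ring "P3 :: ('k::field) poly3 ring"
  by (rule ring_from_type_algebra)

interpretation P3: cring "P3 :: ('k::field) poly3 ring"
  by (rule cring_from_type_algebra)

lemma P3_simps [simp]:
  "carrier (P3 :: ('k::field) poly3 ring) = UNIV"
  "g \<otimes>\<^bsub>P3\<^esub> h = g * (h :: 'k poly3)"
  "g \<oplus>\<^bsub>P3\<^esub> h = g + (h :: 'k poly3)"
  "\<zero>\<^bsub>P3\<^esub> = (0 :: 'k poly3)"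
  "\<one>\<^bsub>P3\<^esub> = (1 :: 'k poly3)"
  by (simp_all add: ring_of_type_algebra_def)

lemma a_inv_P3 [simp]: "\<ominus>\<^bsub>P3\<^esub> (g :: ('k::field) poly3) = - g"
  by (rule P3.minus_equality) simp_all

lemma ideal_P3_iff:
  "ideal (I :: ('k::field) poly3 set) P3
    \<longleftrightarrow> 0 \<in> I \<and> (\<forall>g\<in>I. \<forall>h\<in>I. g + h \<in> I) \<and> (\<forall>g\<in>I. \<forall>h. h * g \<in> I)"
proof
  assume "ideal I P3"
  then interpret ideal I P3 .
  show "0 \<in> I \<and> (\<forall>g\<in>I. \<forall>h\<in>I. g + h \<in> I) \<and> (\<forall>g\<in>I. \<forall>h. h * g \<in> I)"
    using zero_closed a_closed I_l_closed by simp
next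
  assume I: "0 \<in> I \<and> (\<forall>g\<in>I. \<forall>h\<in>I. g + h \<in> I) \<and> (\<forall>g\<in>I. \<forall>h. h * g \<in> I)"
  have neg: "- g \<in> I" if "g \<in> I" for g
  proof -
    have "(- 1) * g \<in> I" using I that by blast
    then show ?thesis by simp
  qed
  show "ideal I P3"
  proof (rule idealI)
    show "subgroup I (add_monoid P3)"
      using I neg by (intro P3.add.subgroupI) (auto simp: a_inv_def[symmetric])
  qed (use I in \<open>auto simp: P3.ring_axioms mult.commute\<close>)
qed

text \<open>P as a vector space over k, which makes spans, independence and basis extension
  available for arguments about quotients of P.\<close>

interpretation V3: vector_space "\<lambda>a (g :: ('k::field) poly3). Const3 a * g"
proof
  fix a b :: 'k and g h :: "'k poly3"
  show "Const3 a * (g + h) = Const3 a * g + Const3 a * h"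
    by (simp add: algebra_simps)
  show "Const3 (a + b) * g = Const3 a * g + Const3 b * g"
    by (simp add: Const3_def single_add algebra_simps)
  show "Const3 a * (Const3 b * g) = Const3 (a * b) * g"
    by (simp add: Const3_def mult.assoc[symmetric] mult_single)
  show "Const3 1 * g = g"
    by (simp add: Const3_def)
qed

lemma lookup_Const3_mult [simp]: "lookup (Const3 a * g) m = a * lookup (g :: ('k::field) poly3) m"
  unfolding Const3_def mult_map_scale_conv_mult[symmetric] by (simp add: Poly_Mapping.map.rep_eq when_def)

lemma Const3_mult_single [simp]:
  "Const3 a * Poly_Mapping.single m b = Poly_Mapping.single m (a * (b :: 'k::field))"
  by (simp add: Const3_def mult_single)

lemma sum_single_lookup:
  assumes "finite A" "keys g \<subseteq> A"
  shows "(\<Sum>m\<in>A. Poly_Mapping.single m (lookup g m)) = g"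
  using assms
  by (intro poly_mapping_eqI) (auto simp: lookup_sum lookup_single when_def in_keys_iff)

lemma lookup_reduce: "lookup (reduce q g) m = (if m \<in> small q then lookup g m else 0)"
proof -
  have "finite (keys g \<inter> small q)" by simp
  then show ?thesis
    by (auto simp: reduce_def lookup_sum lookup_single when_def in_keys_iff)
qed

lemma reduce_add: "reduce q (g + h) = reduce q g + reduce q h"
  by (rule poly_mapping_eqI) (simp add: lookup_reduce lookup_add)

lemma reduce_Const3_mult: "reduce q (Const3 a * g) = Const3 a * reduce q g"
  by (rule poly_mapping_eqI) (simp add: lookup_reduce)

lemma Var3_power: "Var3 v ^ n = Poly_Mapping.single (Poly_Mapping.single v n) (1 :: 'k::field)"
proof (induction n)
  case (Suc n)
  then show ?case
    by (simp add: Var3_def mult_single single_add[symmetric])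
qed simp

text \<open>The ideal is monomial: a polynomial lies in it iff each of its monomials does, and a
  monomial does iff some exponent is at least q.\<close>

lemma frobenius_ci_eq: "frobenius_ci q = {g :: ('k::field) poly3. keys g \<inter> small q = {}}"
proof
  have ideal: "ideal {g :: 'k poly3. keys g \<inter> small q = {}} P3"
    unfolding ideal_P3_iff
  proof (intro conjI ballI allI)
    fix g h :: "'k poly3"
    assume g: "g \<in> {g. keys g \<inter> small q = {}}"
    show "h * g \<in> {g. keys g \<inter> small q = {}}"
    proof -
      have "m \<notin> small q" if "m \<in> keys (h * g)" for m
      proof -
        obtain a b where ab: "m = a + b" "b \<in> keys g"
          using \<open>m \<in> keys (h * g)\<close> keys_mult[of h g] by blast
        then have "b \<notin> small q" using g by blast
        then show ?thesis
          unfolding ab(1) small_iff by (auto simp: lookup_add)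
      qed
      then show ?thesis by blast
    qed
    assume "h \<in> {g. keys g \<inter> small q = {}}"
    with g show "g + h \<in> {g. keys g \<inter> small q = {}}"
      using Poly_Mapping.keys_add[of g h] by blast
  qed simp
  show "frobenius_ci q \<subseteq> {g :: 'k poly3. keys g \<inter> small q = {}}"
    unfolding frobenius_ci_def
  proof (rule P3.genideal_minimal[OF ideal], clarify)
    fix v :: var
    have "\<not> lookup (Poly_Mapping.single v q) v < q" by simp
    then have "Poly_Mapping.single v q \<notin> small q"
      unfolding small_def by blast
    then show "keys (Var3 v ^ q :: 'k poly3) \<inter> small q = {}"
      by (simp add: Var3_power)
  qed
next
  let ?c = "frobenius_ci q :: 'k poly3 set"
  have c: "ideal ?c P3"
    unfolding frobenius_ci_def by (rule P3.genideal_ideal) simp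
  show "{g :: 'k poly3. keys g \<inter> small q = {}} \<subseteq> ?c"
  proof
    fix g :: "'k poly3"
    assume g: "g \<in> {g. keys g \<inter> small q = {}}"
    have *: "Poly_Mapping.single m (lookup g m) \<in> ?c" if "m \<in> keys g" for m
    proof -
      have "m \<notin> small q"
        using g \<open>m \<in> keys g\<close> by blast
      then obtain v where v: "q \<le> lookup m v"
        unfolding small_def by (auto simp: not_less)
      \<comment> \<open>The subtraction is truncated, but it is exact here because
        \<open>q \<le> lookup m v\<close>.\<close>
      then have "m = (m - Poly_Mapping.single v q) + Poly_Mapping.single v q"
        by (intro poly_mapping_eqI) (auto simp: lookup_add lookup_minus lookup_single when_def)
      then have "Poly_Mapping.single m (lookup g m)
          = Poly_Mapping.single (m - Poly_Mapping.single v q) (lookup g m) * Var3 v ^ q"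
        by (simp add: Var3_power mult_single)
      moreover have "Var3 v ^ q \<in> ?c"
        unfolding frobenius_ci_def
        using P3.genideal_self[of "range (\<lambda>v. Var3 v ^ q)"] by auto
      ultimately show ?thesis
        using c unfolding ideal_P3_iff by simp
    qed
    have "(\<Sum>m\<in>A. Poly_Mapping.single m (lookup g m)) \<in> ?c" if "A \<subseteq> keys g" for A
      using finite_subset[OF that finite_keys] that
    proof (induction A rule: finite_induct)
      case (insert m A)
      then show ?case
        using c *[of m] by (simp add: ideal_P3_iff)
    qed (use c in \<open>simp add: ideal_P3_iff\<close>)
    from this[of "keys g"] show "g \<in> ?c"
      by (simp add: sum_single_lookup)
  qed
qed

lemma mem_frobenius_ci_iff: "g \<in> frobenius_ci q \<longleftrightarrow> reduce q g = 0"
  unfolding frobenius_ci_eq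
  by (auto simp: poly_mapping_eq_iff fun_eq_iff lookup_reduce in_keys_iff)

lemma ideal_frobenius_ci: "ideal (frobenius_ci q :: ('k::field) poly3 set) P3"
  unfolding frobenius_ci_def by (rule P3.genideal_ideal) simp

lemma ideal_colon:
  assumes "ideal (c :: ('k::field) poly3 set) P3"
  shows "ideal (colon_ideal c f) P3"
  using assms unfolding ideal_P3_iff colon_ideal_def by (auto simp: algebra_simps)

section \<open>Homogeneous forms and constant terms\<close>

lemma forms_mult:
  assumes "g \<in> forms i" "h \<in> forms j"
  shows "g * h \<in> forms (i + j)"
proof -
  have "int (mdeg m) = i + j" if "m \<in> keys (g * h)" for m
  proof -
    obtain a b where "m = a + b" "a \<in> keys g" "b \<in> keys h"
      using \<open>m \<in> keys (g * h)\<close> keys_mult[of g h] by blast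
    then show ?thesis
      using assms by (auto simp: forms_def mdeg_add)
  qed
  then show ?thesis by (simp add: forms_def)
qed

lemma subspace_forms: "V3.subspace (forms i :: ('k::field) poly3 set)"
  unfolding V3.subspace_def
proof (intro conjI ballI allI)
  fix g h :: "'k poly3" assume "g \<in> forms i" "h \<in> forms i"
  then show "g + h \<in> forms i"
    using Poly_Mapping.keys_add[of g h] unfolding forms_def by blast
next
  fix a and g :: "'k poly3" assume "g \<in> forms i"
  then show "Const3 a * g \<in> forms i"
    by (auto simp: forms_def in_keys_iff)
qed (simp add: forms_def)

lemma reduce_forms: "g \<in> forms i \<Longrightarrow> reduce q g \<in> forms i"
  by (auto simp: forms_def in_keys_iff lookup_reduce split: if_splits)

lemma ideal_no_constant_term: "ideal {g :: ('k::field) poly3. lookup g 0 = 0} P3"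
  unfolding ideal_P3_iff
proof (intro conjI ballI allI)
  fix g h :: "'k poly3"
  assume g: "g \<in> {g. lookup g 0 = 0}"
  have "0 \<notin> keys (h * g)"
  proof
    assume "0 \<in> keys (h * g)"
    then obtain a b where ab: "0 = a + b" "b \<in> keys g"
      using keys_mult[of h g] by blast
    have "lookup (a + b) v = 0" for v
      unfolding ab(1)[symmetric] by simp
    then have "b = 0"
      by (intro poly_mapping_eqI) (simp add: lookup_add)
    with ab g show False by (simp add: in_keys_iff)
  qed
  then show "h * g \<in> {g. lookup g 0 = 0}" by (simp add: in_keys_iff)
qed (auto simp: lookup_add)

text \<open>The polynomials without constant term form an ideal that contains the variables.\<close>

lemma lookup_irrelevant_ideal:
  assumes "g \<in> irrelevant_ideal"
  shows "lookup g 0 = (0 :: 'k::field)"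
proof -
  have "irrelevant_ideal \<subseteq> {g :: 'k poly3. lookup g 0 = 0}"
    unfolding irrelevant_ideal_def
  proof (rule P3.genideal_minimal[OF ideal_no_constant_term], clarify)
    fix v :: var
    have "Poly_Mapping.single v (1 :: nat) \<noteq> 0"
      by (simp add: poly_mapping_eq_iff fun_eq_iff lookup_single when_def)
    then show "lookup (Var3 v :: 'k poly3) 0 = 0"
      by (simp add: Var3_def lookup_single_not_eq)
  qed
  with assms show ?thesis by blast
qed

text \<open>The set \<open>M\<close> selects the monomials: \<open>UNIV\<close> gives
  representatives of a basis of P/c, a condition on the degree gives those of one graded
  piece.\<close>

definition small_monoms :: "nat \<Rightarrow> (var \<Rightarrow>\<^sub>0 nat) set \<Rightarrow> ('k::field) poly3 set" where
  "small_monoms q M = (\<lambda>m. Poly_Mapping.single m 1) ` (small q \<inter> M)"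

lemma small_monoms:
  shows "finite (small_monoms q M :: ('k::field) poly3 set)"
    and "card (small_monoms q M :: ('k::field) poly3 set) = card (small q \<inter> M)"
    and "V3.independent (small_monoms q M :: ('k::field) poly3 set)"
    and "V3.span (small_monoms q M :: ('k::field) poly3 set) = {g. keys g \<subseteq> small q \<inter> M}"
proof -
  let ?X = "\<lambda>m. Poly_Mapping.single m (1 :: 'k)"
  have inj: "inj_on ?X (small q \<inter> M)"
  proof (rule inj_onI)
    fix m n assume "?X m = ?X n"
    then have "keys (?X m) = keys (?X n)" by (rule arg_cong)
    then show "m = n" by simp
  qed
  have fin: "finite (small q \<inter> M)"
    using card_small(1) by simp
  then show fin': "finite (small_monoms q M :: ('k::field) poly3 set)"
    by (simp add: small_monoms_def)
  show "card (small_monoms q M :: ('k::field) poly3 set) = card (small q \<inter> M)"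
    using inj by (simp add: small_monoms_def card_image)
  show "V3.independent (small_monoms q M :: ('k::field) poly3 set)"
  proof (rule V3.independent_if_scalars_zero[OF fin'])
    fix u :: "'k poly3 \<Rightarrow> 'k" and x :: "'k poly3"
    assume sum0: "(\<Sum>x\<in>small_monoms q M. Const3 (u x) * x) = 0" and "x \<in> small_monoms q M"
    then obtain n where n: "n \<in> small q \<inter> M" "x = ?X n"
      by (auto simp: small_monoms_def)
    have "0 = lookup (\<Sum>m\<in>small q \<inter> M. Const3 (u (?X m)) * ?X m) n"
      using sum0 inj by (simp add: small_monoms_def sum.reindex)
    also have "\<dots> = u x"
      using n fin by (simp add: lookup_sum lookup_single when_def)
    finally show "u x = 0" by simp
  qed
  show "V3.span (small_monoms q M :: ('k::field) poly3 set) = {g. keys g \<subseteq> small q \<inter> M}"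
  proof (rule V3.span_subspace)
    show "V3.subspace {g :: 'k poly3. keys g \<subseteq> small q \<inter> M}"
      unfolding V3.subspace_def
    proof (intro conjI ballI allI)
      fix g h :: "'k poly3"
      assume "g \<in> {g. keys g \<subseteq> small q \<inter> M}" "h \<in> {g. keys g \<subseteq> small q \<inter> M}"
      then show "g + h \<in> {g. keys g \<subseteq> small q \<inter> M}"
        using Poly_Mapping.keys_add[of g h] by blast
    next
      fix a and g :: "'k poly3"
      assume "g \<in> {g. keys g \<subseteq> small q \<inter> M}"
      moreover have "keys (Const3 a * g) \<subseteq> keys g"
        by (auto simp: in_keys_iff)
      ultimately show "Const3 a * g \<in> {g. keys g \<subseteq> small q \<inter> M}" by blast
    qed simp
    show "{g :: 'k poly3. keys g \<subseteq> small q \<inter> M} \<subseteq> V3.span (small_monoms q M)"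
    proof
      fix g :: "'k poly3" assume g: "g \<in> {g. keys g \<subseteq> small q \<inter> M}"
      have "(\<Sum>m\<in>small q \<inter> M. Const3 (lookup g m) * ?X m) \<in> V3.span (small_monoms q M)"
        by (intro V3.span_sum V3.span_scale V3.span_base) (auto simp: small_monoms_def)
      then show "g \<in> V3.span (small_monoms q M)"
        using g fin by (simp add: sum_single_lookup)
    qed
    show "small_monoms q M \<subseteq> {g :: 'k poly3. keys g \<subseteq> small q \<inter> M}"
      unfolding small_monoms_def by (rule image_subsetI) simp
  qed
qed

section \<open>Dimensions of quotient rings\<close>

lemma subfield_Const3: "subfield (range (Const3 :: 'k::field \<Rightarrow> _)) P3"
proof -
  interpret K: field "ring_of_type_algebra :: 'k ring"
    by (rule field_from_type_algebra)
  have hom: "ring_hom_ring (ring_of_type_algebra :: 'k ring) P3 Const3"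
    by (rule ring_hom_ringI2[OF K.ring_axioms P3.ring_axioms], rule ring_hom_memI)
       (simp_all add: ring_of_type_algebra_def Const3_def mult_single single_add)
  have "subfield (Const3 ` carrier (ring_of_type_algebra :: 'k ring)) P3"
    by (rule ring_hom_ring.img_is_subfield(2)[OF hom K.carrier_is_subfield]) simp
  then show ?thesis
    by (simp add: ring_of_type_algebra_def)
qed

text \<open>If \<open>B\<close> spans the kernel of \<open>h\<close> on the span of
  \<open>B \<union> C\<close>, then \<open>h\<close> maps \<open>C\<close> to a basis of the image.
  This carries independence in P over to the inductively defined dimension in the target ring: each
  element of \<open>C\<close> contributes one line extension.\<close>

lemma dimension_image:
  fixes h :: "('k::field) poly3 \<Rightarrow> 'b" and A :: "'b ring"
  assumes hom: "ring_hom_ring P3 A h" and "finite C"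
    and "V3.independent (B \<union> C)" "B \<inter> C = {}"
    and "\<And>x. x \<in> V3.span (B \<union> C) \<Longrightarrow> h x = \<zero>\<^bsub>A\<^esub> \<longleftrightarrow> x \<in> V3.span B"
  shows "ring.dimension A (card C) (h ` range Const3) (h ` V3.span (B \<union> C))"
  using assms(2-)
proof (induction C rule: finite_induct)
  case empty
  interpret ring_hom_ring P3 A h by (rule hom)
  have "h ` V3.span B = {\<zero>\<^bsub>A\<^esub>}"
    using empty V3.span_zero by force
  then show ?case
    using ring.dimension.zero_dim[OF S.ring_axioms] by simp
next
  case (insert c C)
  interpret ring_hom_ring P3 A h by (rule hom)
  have BcC: "B \<union> insert c C = insert c (B \<union> C)" by simp
  have sub: "V3.span (B \<union> C) \<subseteq> V3.span (B \<union> insert c C)"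
    by (rule V3.span_mono) auto
  have c: "c \<notin> V3.span (B \<union> C)"
    using insert.prems(1,2) insert.hyps(2) unfolding BcC V3.independent_insert by auto
  have dim: "S.dimension (card C) (h ` range Const3) (h ` V3.span (B \<union> C))"
  proof (rule insert.IH)
    show "V3.independent (B \<union> C)"
      by (rule V3.independent_mono[OF insert.prems(1)]) auto
  qed (use insert.prems sub in auto)
  \<comment> \<open>If \<open>h c = h x\<close>, then \<open>c - x\<close> lies in the kernel, hence
    in the span of \<open>B\<close>, which contradicts the independence of \<open>c\<close> from
    \<open>B \<union> C\<close>.\<close>
  have "h c \<notin> h ` V3.span (B \<union> C)"
  proof
    assume "h c \<in> h ` V3.span (B \<union> C)"
    then obtain x where x: "x \<in> V3.span (B \<union> C)" "h c = h x" by blast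
    have "c - x \<in> V3.span (B \<union> insert c C)"
      using x(1) sub by (intro V3.span_diff[OF V3.span_base]) auto
    moreover have "h (c - x) = \<zero>\<^bsub>A\<^esub>"
      using hom_add[of c "- x"] hom_a_inv[of x] x(2) by (simp add: S.r_neg)
    ultimately have "c - x \<in> V3.span B"
      using insert.prems(3) by blast
    then have "c - x \<in> V3.span (B \<union> C)"
      using V3.span_mono[of B "B \<union> C"] by blast
    then have "(c - x) + x \<in> V3.span (B \<union> C)"
      using x(1) V3.span_add by blast
    then show False using c by simp
  qed
  from ring.dimension.Suc_dim[OF S.ring_axioms _ this dim]
  have "S.dimension (Suc (card C)) (h ` range Const3)
      (S.line_extension (h ` range Const3) (h c) (h ` V3.span (B \<union> C)))"
    by simp
  moreover have "S.line_extension (h ` range Const3) (h c) (h ` V3.span (B \<union> C))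
      = h ` V3.span (B \<union> insert c C)"
  proof -
    have ext: "h (Const3 k) \<otimes>\<^bsub>A\<^esub> h c \<oplus>\<^bsub>A\<^esub> h x = h (Const3 k * c + x)" for k x
      using hom_add[of "Const3 k * c" x] hom_mult[of "Const3 k" c] by simp
    show ?thesis
    proof (intro equalityI subsetI)
      fix y assume "y \<in> S.line_extension (h ` range Const3) (h c) (h ` V3.span (B \<union> C))"
      then obtain k x where "x \<in> V3.span (B \<union> C)" "y = h (Const3 k * c + x)"
        unfolding S.line_extension_mem_iff using ext by auto
      moreover from this have "Const3 k * c + x \<in> V3.span (B \<union> insert c C)"
        using sub by (intro V3.span_add V3.span_scale) (auto intro: V3.span_base)
      ultimately show "y \<in> h ` V3.span (B \<union> insert c C)" by blast
    next
      fix y assume "y \<in> h ` V3.span (B \<union> insert c C)"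
      then obtain z where z: "z \<in> V3.span (insert c (B \<union> C))" "y = h z" by auto
      then obtain k where k: "z - Const3 k * c \<in> V3.span (B \<union> C)"
        using V3.span_breakdown_eq by blast
      have "y = h (Const3 k) \<otimes>\<^bsub>A\<^esub> h c \<oplus>\<^bsub>A\<^esub> h (z - Const3 k * c)"
        unfolding ext z(2) by simp
      with k show "y \<in> S.line_extension (h ` range Const3) (h c) (h ` V3.span (B \<union> C))"
        unfolding S.line_extension_mem_iff by blast
    qed
  qed
  ultimately show ?case
    using insert.hyps by simp
qed

text \<open>The condition \<open>h 1 \<noteq> \<zero>\<close> makes the image of k a subfield, over
  which the dimension is a well-defined number.\<close>

lemma dim_image:
  fixes h :: "('k::field) poly3 \<Rightarrow> 'b" and A :: "'b ring"
  assumes hom: "ring_hom_ring P3 A h" and one: "h 1 \<noteq> \<zero>\<^bsub>A\<^esub>"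
    and "finite C" "V3.independent (B \<union> C)" "B \<inter> C = {}"
    and "\<And>x. x \<in> V3.span (B \<union> C) \<Longrightarrow> h x = \<zero>\<^bsub>A\<^esub> \<longleftrightarrow> x \<in> V3.span B"
  shows "(ring.dim A over range (\<lambda>a. h (Const3 a))) (h ` V3.span (B \<union> C)) = card C"
proof -
  interpret ring_hom_ring P3 A h by (rule hom)
  have "\<one>\<^bsub>A\<^esub> \<noteq> \<zero>\<^bsub>A\<^esub>"
    using one hom_one by simp
  from S.dimI[OF img_is_subfield(2)[OF subfield_Const3 this] dimension_image[OF hom assms(3-)]]
  show ?thesis
    by (simp add: image_image)
qed

section \<open>Cosets and the Hilbert function of the colon ideal\<close>

lemma coset3_eq_iff:
  assumes "ideal (J :: ('k::field) poly3 set) P3"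
  shows "coset3 J g = coset3 J h \<longleftrightarrow> g - h \<in> J"
  using P3.quotient_eq_iff_same_a_r_cos[OF assms, of g h] by (simp add: a_minus_def)

lemma coset3_eq_zero_iff:
  assumes "ideal (J :: ('k::field) poly3 set) P3"
  shows "coset3 J g = \<zero>\<^bsub>P3 Quot J\<^esub> \<longleftrightarrow> g \<in> J"
proof -
  interpret ideal J P3 by (rule assms)
  interpret ring_hom_ring P3 "P3 Quot J" "coset3 J" by (rule rcos_ring_hom_ring)
  have "coset3 J 0 = \<zero>\<^bsub>P3 Quot J\<^esub>"
    using hom_zero by simp
  then show ?thesis
    using coset3_eq_iff[OF assms, of g 0] by simp
qed

lemma ring_hom_ring_coset3:
  "ideal (J :: ('k::field) poly3 set) P3 \<Longrightarrow> ring_hom_ring P3 (P3 Quot J) (coset3 J)"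
  by (rule ideal.rcos_ring_hom_ring)

lemma reduce_minus: "reduce q (g - h) = reduce q g - reduce q h"
  by (rule poly_mapping_eqI) (simp add: lookup_reduce lookup_minus)

lemma reduce_sum_mult:
  fixes f :: "('k::field) poly3"
  shows "reduce q ((\<Sum>x\<in>A. Const3 (u x) * x) * f) = (\<Sum>x\<in>A. Const3 (u x) * reduce q (x * f))"
proof (induction A rule: infinite_finite_induct)
  case (insert x A)
  then show ?case
    by (simp add: distrib_right reduce_add mult.assoc reduce_Const3_mult)
qed (simp_all add: reduce_def)

lemma subspace_reduce_mult:
  fixes f :: "('k::field) poly3"
  assumes "V3.subspace V"
  shows "V3.subspace ((\<lambda>g. reduce q (g * f)) ` V)"
  unfolding V3.subspace_def
proof (intro conjI ballI allI)
  show "0 \<in> (\<lambda>g. reduce q (g * f)) ` V"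
    using V3.subspace_0[OF assms] by (rule rev_image_eqI) (simp add: reduce_def)
next
  fix x y assume "x \<in> (\<lambda>g. reduce q (g * f)) ` V" "y \<in> (\<lambda>g. reduce q (g * f)) ` V"
  then obtain g h where "g \<in> V" "x = reduce q (g * f)" "h \<in> V" "y = reduce q (h * f)" by blast
  then show "x + y \<in> (\<lambda>g. reduce q (g * f)) ` V"
    using V3.subspace_add[OF assms, of g h]
    by (intro rev_image_eqI[of "g + h"]) (simp_all add: distrib_right reduce_add)
next
  fix a x assume "x \<in> (\<lambda>g. reduce q (g * f)) ` V"
  then obtain g where "g \<in> V" "x = reduce q (g * f)" by blast
  then show "Const3 a * x \<in> (\<lambda>g. reduce q (g * f)) ` V"
    using V3.subspace_scale[OF assms, of g a]
    by (intro rev_image_eqI[of "Const3 a * g"]) (simp_all add: mult.assoc reduce_Const3_mult)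
qed

lemma mem_colon_frobenius_iff:
  "g \<in> colon_ideal (frobenius_ci q) f \<longleftrightarrow> reduce q (g * f) = 0"
  by (simp add: colon_ideal_def mem_frobenius_ci_iff)

text \<open>Multiplication by \<open>f\<close> identifies \<open>P/(c : f)\<close> with \<open>(f P + c)/c\<close>, and the latter is
  computed inside the span of the monomials outside \<open>c\<close>.\<close>
lemma hilbert_fun_colon:
  fixes f :: "('k::field) poly3"
  assumes f: "reduce q f \<noteq> 0" and U: "finite U" "V3.independent U"
    and span_U: "V3.span U = (\<lambda>g. reduce q (g * f)) ` forms i"
  shows "hilbert_fun (colon_ideal (frobenius_ci q) f) i = card U"
proof -
  let ?J = "colon_ideal (frobenius_ci q) f"
  have J: "ideal ?J P3"
    by (rule ideal_colon[OF ideal_frobenius_ci])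
  \<comment> \<open>Each basis vector is lifted to a form of degree \<open>i\<close>; the classes of
    these lifts will be the basis of the graded piece.\<close>
  have "\<forall>x\<in>U. \<exists>g. g \<in> forms i \<and> reduce q (g * f) = x"
  proof
    fix x assume "x \<in> U"
    then have "x \<in> (\<lambda>g. reduce q (g * f)) ` forms i"
      unfolding span_U[symmetric] by (rule V3.span_base)
    then show "\<exists>g. g \<in> forms i \<and> reduce q (g * f) = x" by auto
  qed
  then obtain l where l: "\<And>x. x \<in> U \<Longrightarrow> l x \<in> forms i" "\<And>x. x \<in> U \<Longrightarrow> reduce q (l x * f) = x"
    by metis
  have inj: "inj_on l U"
    by (rule inj_onI) (metis l(2))
  have fin: "finite (l ` U)" using U by simp
  have T: "reduce q ((\<Sum>x\<in>l ` U. Const3 (u x) * x) * f) = (\<Sum>x\<in>U. Const3 (u (l x)) * x)" for u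
    unfolding reduce_sum_mult by (simp add: sum.reindex[OF inj] l(2) cong: sum.cong)
  \<comment> \<open>Reduced multiplication by \<open>f\<close> sends the lifts to the independent
    set \<open>U\<close>, so it kills no nontrivial combination of them.\<close>
  have trivial: "u x = 0"
    if asm: "reduce q ((\<Sum>x\<in>l ` U. Const3 (u x) * x) * f) = 0" "x \<in> l ` U" for u x
  proof -
    obtain y where y: "y \<in> U" "x = l y" using asm(2) by blast
    then show ?thesis
      using V3.independentD[OF U(2,1) subset_refl _ y(1), of "\<lambda>x. u (l x)"] asm(1)
      unfolding T by simp
  qed
  have indep: "V3.independent (l ` U)"
    by (rule V3.independent_if_scalars_zero[OF fin]) (rule trivial, simp_all add: reduce_def)
  have ker: "coset3 ?J x = \<zero>\<^bsub>P3 Quot ?J\<^esub> \<longleftrightarrow> x \<in> V3.span {}"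
    if x: "x \<in> V3.span ({} \<union> l ` U)" for x
  proof -
    obtain u where u: "x = (\<Sum>y\<in>l ` U. Const3 (u y) * y)"
      using x V3.span_finite[OF fin] by auto
    have "x = 0" if "reduce q (x * f) = 0"
      unfolding u using trivial[OF that[unfolded u]]
      by (intro sum.neutral) (simp add: Const3_def)
    then show ?thesis
      by (auto simp: coset3_eq_zero_iff[OF J] mem_colon_frobenius_iff reduce_def)
  qed
  have "coset3 ?J ` V3.span ({} \<union> l ` U) = graded_piece ?J i"
    unfolding graded_piece_def
  proof (intro equalityI)
    have "V3.span (l ` U) \<subseteq> forms i"
      by (rule V3.span_minimal) (use l subspace_forms in auto)
    then show "coset3 ?J ` V3.span ({} \<union> l ` U) \<subseteq> coset3 ?J ` forms i" by auto
    show "coset3 ?J ` forms i \<subseteq> coset3 ?J ` V3.span ({} \<union> l ` U)"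
    proof (rule image_subsetI)
      fix g assume "g \<in> (forms i :: 'k poly3 set)"
      then have "reduce q (g * f) \<in> V3.span U"
        using span_U by blast
      then obtain u where u: "reduce q (g * f) = (\<Sum>x\<in>U. Const3 (u x) * x)"
        using V3.span_finite[OF U(1)] by auto
      \<comment> \<open>The combination of lifts with the coefficients of the image of
        \<open>g\<close>: both have the same image, so they differ by an element of the colon
        ideal.\<close>
      define y where "y = (\<Sum>x\<in>l ` U. Const3 (u (inv_into U l x)) * x)"
      have "y \<in> V3.span ({} \<union> l ` U)"
        unfolding y_def by (intro V3.span_sum V3.span_scale V3.span_base) simp
      moreover have "reduce q (y * f) = (\<Sum>x\<in>U. Const3 (u x) * x)"
        unfolding y_def T by (rule sum.cong) (simp_all add: inj)
      then have "coset3 ?J g = coset3 ?J y"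
        unfolding coset3_eq_iff[OF J] mem_colon_frobenius_iff
        by (simp add: left_diff_distrib reduce_minus u)
      ultimately show "coset3 ?J g \<in> coset3 ?J ` V3.span ({} \<union> l ` U)" by blast
    qed
  qed
  moreover have "coset3 ?J 1 \<noteq> \<zero>\<^bsub>P3 Quot ?J\<^esub>"
    using f by (simp add: coset3_eq_zero_iff[OF J] mem_colon_frobenius_iff)
  moreover have "card (l ` U) = card U"
    by (rule card_image[OF inj])
  ultimately show ?thesis
    using dim_image[OF ring_hom_ring_coset3[OF J] _ fin, of "{}"] indep ker
    by (simp add: hilbert_fun_def)
qed

section \<open>The quotient defining the Hilbert-Kunz function\<close>

lemma carrier_FactRing: "carrier (R Quot I) = (+>\<^bsub>R\<^esub>) I ` carrier R"
  by (auto simp: FactRing_def A_RCOSETS_def')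

lemma pow_P3 [simp]: "g [^]\<^bsub>P3\<^esub> (n :: nat) = (g :: ('k::field) poly3) ^ n"
  by (induction n) (simp_all add: mult.commute)

lemma PIdl_P3: "PIdl\<^bsub>P3\<^esub> f = range (\<lambda>b. b * (f :: ('k::field) poly3))"
  by (auto simp: cgenideal_def)

text \<open>The quotient of R by its Frobenius power is P/(c + fP). A basis \<open>B\<close> of the
  image of fP is extended to a basis of the q^3-dimensional span of the small monomials, and the
  added vectors represent a basis of that quotient.\<close>

lemma HK_add_card:
  fixes f :: "('k::field) poly3"
  assumes f0: "lookup f 0 = 0" and "q > 0" and B: "finite B" "V3.independent B"
    and span_B: "V3.span B = range (\<lambda>g. reduce q (g * f))"
  shows "HK f q + card B = q ^ 3"
proof -
  let ?R = "hypersurface f" and ?F = "frobenius_power f q"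
  let ?p = "coset3 (PIdl\<^bsub>P3\<^esub> f)"
  let ?A = "?R Quot ?F" and ?h = "\<lambda>g. ?F +>\<^bsub>?R\<^esub> ?p g"
  \<comment> \<open>The ideal c + fP, which turns out to be the preimage of the Frobenius power in
    P.\<close>
  define I where "I = {a + b * f | a b. a \<in> frobenius_ci q}"
  have PIdl: "ideal (PIdl\<^bsub>P3\<^esub> f) P3"
    by (rule P3.cgenideal_ideal) simp
  have hom1: "ring_hom_ring P3 ?R ?p"
    unfolding hypersurface_def by (rule ring_hom_ring_coset3[OF PIdl])
  interpret h1: ring_hom_ring P3 ?R ?p by (rule hom1)
  have F: "ideal ?F ?R"
    unfolding frobenius_power_def by (rule h1.S.genideal_ideal) auto
  have hom2: "ring_hom_ring ?R ?A ((+>\<^bsub>?R\<^esub>) ?F)"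
    by (rule ideal.rcos_ring_hom_ring[OF F])
  interpret h2: ring_hom_ring ?R ?A "(+>\<^bsub>?R\<^esub>) ?F" by (rule hom2)
  have hom: "ring_hom_ring P3 ?A ?h"
    using ring_hom_ringI2[OF P3.ring_axioms h2.S.ring_axioms ring_hom_trans[OF h1.homh h2.homh]]
    by (simp add: comp_def)
  interpret c: ideal "frobenius_ci q" P3 by (rule ideal_frobenius_ci)
  have I: "ideal I P3"
    unfolding ideal_P3_iff
  proof (intro conjI ballI allI)
    have "0 = 0 + 0 * f" by simp
    then show "0 \<in> I"
      unfolding I_def using c.zero_closed by fastforce
  next
    fix x y assume "x \<in> I" "y \<in> I"
    then obtain a b a' b' where "x = a + b * f" "y = a' + b' * f"
      "a \<in> frobenius_ci q" "a' \<in> frobenius_ci q"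
      unfolding I_def by blast
    then have "x + y = (a + a') + (b + b') * f" "a + a' \<in> frobenius_ci q"
      using c.a_closed by (simp_all add: algebra_simps)
    then show "x + y \<in> I" unfolding I_def by blast
  next
    fix x g assume "x \<in> I"
    then obtain a b where "x = a + b * f" "a \<in> frobenius_ci q"
      unfolding I_def by blast
    then have "g * x = g * a + (g * b) * f" "g * a \<in> frobenius_ci q"
      using c.I_l_closed by (simp_all add: algebra_simps)
    then show "g * x \<in> I" unfolding I_def by blast
  qed
  have PIdl_I: "PIdl\<^bsub>P3\<^esub> f \<subseteq> I"
  proof
    fix x assume "x \<in> PIdl\<^bsub>P3\<^esub> f"
    then obtain b where "x = 0 + b * f" by (auto simp: PIdl_P3)
    then show "x \<in> I" unfolding I_def using c.zero_closed by fastforce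
  qed
  have c_I: "frobenius_ci q \<subseteq> I"
  proof
    fix a assume "a \<in> (frobenius_ci q :: 'k poly3 set)"
    moreover have "a = a + 0 * f" by simp
    ultimately show "a \<in> I" unfolding I_def by blast
  qed
  have pow: "?p (Var3 v) [^]\<^bsub>?R\<^esub> q = ?p (Var3 v ^ q)" for v
    using h1.hom_nat_pow[of "Var3 v" q] by simp
  \<comment> \<open>One direction holds because the image of \<open>I\<close> is an ideal containing
    the generators, the other because the preimage of \<open>?F\<close> is an ideal containing c and
    \<open>f\<close>.\<close>
  have mem_F: "?p g \<in> ?F \<longleftrightarrow> g \<in> I" for g
  proof
    have "?F \<subseteq> ?p ` I"
      unfolding frobenius_power_def
    proof (rule h1.S.genideal_minimal)
      show "ideal (?p ` I) ?R"
        unfolding hypersurface_def by (rule P3.ring_ideal_imp_quot_ideal[OF PIdl I])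
      show "range (\<lambda>v. ?p (Var3 v) [^]\<^bsub>?R\<^esub> q) \<subseteq> ?p ` I"
        unfolding pow using c_I P3.genideal_self[of "range (\<lambda>v. Var3 v ^ q)"]
        unfolding frobenius_ci_def by auto
    qed
    moreover assume "?p g \<in> ?F"
    ultimately obtain i where i: "i \<in> I" "?p g = ?p i" by blast
    then have "g - i \<in> I"
      using PIdl_I coset3_eq_iff[OF PIdl] by blast
    then have "(g - i) + i \<in> I"
      using i(1) I unfolding ideal_P3_iff by blast
    then show "g \<in> I" by simp
  next
    let ?V = "{g. ?p g \<in> ?F}"
    have V: "ideal ?V P3"
      using h1.ideal_vimage[OF F] by simp
    have "frobenius_ci q \<subseteq> ?V"
      unfolding frobenius_ci_def
    proof (rule P3.genideal_minimal[OF V])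
      have "range (\<lambda>v. ?p (Var3 v ^ q)) \<subseteq> ?F"
        unfolding frobenius_power_def pow by (rule h1.S.genideal_self) auto
      then show "range (\<lambda>v. Var3 v ^ q) \<subseteq> ?V" by auto
    qed
    moreover have "f \<in> ?V"
    proof -
      have "?p f = \<zero>\<^bsub>?R\<^esub>"
        unfolding hypersurface_def coset3_eq_zero_iff[OF PIdl]
        by (rule P3.cgenideal_self) simp
      then show ?thesis
        using ideal.axioms(1)[OF F] additive_subgroup.zero_closed by fastforce
    qed
    ultimately show "g \<in> I \<Longrightarrow> ?p g \<in> ?F"
      using V unfolding ideal_P3_iff I_def by auto
  qed
  have ker: "?h g = \<zero>\<^bsub>?A\<^esub> \<longleftrightarrow> g \<in> I" for g
  proof -
    have "?p g \<ominus>\<^bsub>?R\<^esub> \<zero>\<^bsub>?R\<^esub> = ?p g"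
      by (simp add: a_minus_def)
    then have "?p g \<in> ?F \<longleftrightarrow> ?h g = ?F +>\<^bsub>?R\<^esub> \<zero>\<^bsub>?R\<^esub>"
      using h1.S.quotient_eq_iff_same_a_r_cos[OF F, of "?p g" "\<zero>\<^bsub>?R\<^esub>"] by simp
    then show ?thesis
      using mem_F h2.hom_zero by simp
  qed
  have red_I: "g - reduce q g \<in> I" for g
  proof -
    have "g - reduce q g \<in> frobenius_ci q"
      by (auto simp: frobenius_ci_eq in_keys_iff lookup_minus lookup_reduce)
    then show ?thesis using c_I by blast
  qed
  \<comment> \<open>The quotient is nonzero because no element of c + fP has a constant term:
    \<open>q > 0\<close> ensures this for c, and \<open>f0\<close> for the multiples of
    \<open>f\<close>.\<close>
  have one: "?h 1 \<noteq> \<zero>\<^bsub>?A\<^esub>"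
  proof
    assume "?h 1 = \<zero>\<^bsub>?A\<^esub>"
    then have "1 \<in> I" using ker by simp
    then obtain a b where ab: "1 = a + b * f" "a \<in> frobenius_ci q"
      unfolding I_def by blast
    have "lookup a 0 = 0"
      using ab(2) \<open>q > 0\<close> by (auto simp: frobenius_ci_eq in_keys_iff small_def)
    moreover have "lookup (b * f) 0 = 0"
      using ideal.I_l_closed[OF ideal_no_constant_term, of f b] f0 by simp
    moreover have "lookup a 0 + lookup (b * f) 0 = 1"
      unfolding lookup_add[symmetric] ab(1)[symmetric] by simp
    ultimately show False by simp
  qed
  let ?W = "V3.span (small_monoms q UNIV) :: 'k poly3 set"
  note W = small_monoms[where 'k = 'k and q = q and M = UNIV]
  have reduce_W: "reduce q x = x" if "x \<in> ?W" for x
    using that unfolding W(4)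
    by (intro poly_mapping_eqI) (auto simp: lookup_reduce in_keys_iff subset_iff)
  have W_reduce: "reduce q g \<in> ?W" for g :: "'k poly3"
    unfolding W(4) by (auto simp: in_keys_iff lookup_reduce split: if_splits)
  have "B \<subseteq> ?W"
    using V3.span_superset[of B] span_B W_reduce by auto
  then obtain B' where B': "B \<subseteq> B'" "B' \<subseteq> ?W" "V3.independent B'" "?W \<subseteq> V3.span B'"
    using V3.maximal_independent_subset_extend[OF _ B(2)] by metis
  \<comment> \<open>Exchange is applied in both directions between \<open>B'\<close> and the small
    monomials, which gives equal cardinalities.\<close>
  have fin: "finite B'" "card B' \<le> card (small_monoms q UNIV :: 'k poly3 set)"
    using V3.independent_span_bound[OF W(1) B'(3,2)] by auto
  have "small_monoms q UNIV \<subseteq> V3.span B'"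
    using B'(4) V3.span_superset by blast
  from V3.independent_span_bound[OF fin(1) W(3) this] fin(2)
  have card: "card B' = q ^ 3"
    using W(2) card_small(2) by simp
  have span_B': "V3.span B' = ?W"
    using B'(4) V3.span_minimal[OF B'(2)] by (simp add: V3.subspace_span equalityI)
  define C where "C = B' - B"
  have BC: "B \<union> C = B'" "B \<inter> C = {}" "finite C"
    using B'(1) fin(1) by (auto simp: C_def)
  \<comment> \<open>An element of the span is fixed by \<open>reduce\<close>, and reducing
    \<open>a + b * f\<close> with \<open>a\<close> in c leaves only
    \<open>reduce q (b * f)\<close>.\<close>
  have ker_span: "?h x = \<zero>\<^bsub>?A\<^esub> \<longleftrightarrow> x \<in> V3.span B" if x: "x \<in> V3.span (B \<union> C)" for x
  proof
    assume "?h x = \<zero>\<^bsub>?A\<^esub>"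
    then obtain a b where ab: "x = a + b * f" "a \<in> frobenius_ci q"
      unfolding ker I_def by blast
    then have "reduce q x = reduce q (b * f)"
      by (simp add: reduce_add mem_frobenius_ci_iff)
    then show "x \<in> V3.span B"
      using x reduce_W by (simp add: BC(1) span_B' span_B)
  next
    assume "x \<in> V3.span B"
    then obtain b where b: "x = reduce q (b * f)"
      unfolding span_B by blast
    have "b * f \<in> I"
      using PIdl_I by (auto simp: PIdl_P3)
    moreover have "- (b * f - x) \<in> I"
      using red_I[of "b * f"] I unfolding b ideal_P3_iff by (metis mult_minus1)
    ultimately have "b * f + - (b * f - x) \<in> I"
      using I unfolding ideal_P3_iff by blast
    then show "?h x = \<zero>\<^bsub>?A\<^esub>"
      unfolding ker by simp
  qed
  have "?h ` V3.span (B \<union> C) = carrier ?A"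
  proof -
    have R: "carrier ?R = range ?p"
      by (simp add: hypersurface_def carrier_FactRing)
    have carrier: "carrier ?A = range ?h"
      unfolding carrier_FactRing R image_image by (rule refl)
    have "?h g = ?h (reduce q g)" for g
    proof -
      interpret h: ring_hom_ring P3 ?A ?h by (rule hom)
      have "?h g = ?h ((g - reduce q g) \<oplus>\<^bsub>P3\<^esub> reduce q g)"
        by simp
      also have "\<dots> = ?h (g - reduce q g) \<oplus>\<^bsub>?A\<^esub> ?h (reduce q g)"
        by (rule h.hom_add) simp_all
      also have "?h (g - reduce q g) = \<zero>\<^bsub>?A\<^esub>"
        using red_I ker by blast
      finally show ?thesis by simp
    qed
    then show ?thesis
      unfolding carrier BC(1) span_B' using W_reduce by blast
  qed
  then have "HK f q = card C"
    using dim_image[OF hom one BC(3) _ BC(2) ker_span] B'(3) BC(1)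
    by (simp add: HK_def Let_def)
  then show ?thesis
    using card_Un_disjoint[OF B(1) BC(3,2)] BC(1) card by simp
qed

section \<open>The Hilbert-Kunz function\<close>

lemma lookup_single_mult:
  "lookup (Poly_Mapping.single m (a :: 'k::field) * (f :: 'k poly3)) (m + n) = a * lookup f n"
proof -
  have "Poly_Mapping.single m a * f
      = Poly_Mapping.single m a * (\<Sum>k\<in>keys f. Poly_Mapping.single k (lookup f k))"
    by (simp add: sum_single_lookup)
  also have "\<dots> = (\<Sum>k\<in>keys f. Poly_Mapping.single (m + k) (a * lookup f k))"
    by (simp add: sum_distrib_left mult_single)
  finally show ?thesis
    by (auto simp: lookup_sum lookup_single when_def in_keys_iff)
qed

text \<open>The case \<open>f = 1\<close> of the colon computation, since (c : 1) = c;
  \<open>q > 0\<close> ensures that 1 is not in c.\<close>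

lemma hilbert_fun_frobenius_ci:
  assumes "q > 0"
  shows "int (hilbert_fun (frobenius_ci q :: ('k::field) poly3 set) i) = triples_count q i"
proof -
  let ?U = "small_monoms q {m. int (mdeg m) = i} :: 'k poly3 set"
  note U = small_monoms[where 'k = 'k and q = q and M = "{m. int (mdeg m) = i}"]
  have "V3.span ?U = (\<lambda>g. reduce q (g * 1)) ` forms i"
  proof (intro equalityI subsetI)
    fix g assume "g \<in> V3.span ?U"
    then have g: "keys g \<subseteq> small q" "g \<in> forms i"
      unfolding U(4) forms_def by auto
    have "reduce q g = g"
      using g(1) by (intro poly_mapping_eqI) (auto simp: lookup_reduce in_keys_iff subset_iff)
    then have "g = reduce q (g * 1)" by simp
    with g(2) show "g \<in> (\<lambda>g. reduce q (g * 1)) ` forms i" by (rule rev_image_eqI)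
  next
    fix x assume "x \<in> (\<lambda>g :: 'k poly3. reduce q (g * 1)) ` forms i"
    then obtain g where g: "g \<in> forms i" "x = reduce q g" by auto
    have "keys x \<subseteq> small q"
      unfolding g(2) by (auto simp: lookup_reduce in_keys_iff split: if_splits)
    moreover have "x \<in> forms i"
      unfolding g(2) by (rule reduce_forms[OF g(1)])
    ultimately show "x \<in> V3.span ?U"
      unfolding U(4) forms_def by auto
  qed
  moreover have "reduce q (1 :: 'k poly3) \<noteq> 0"
  proof
    assume "reduce q (1 :: 'k poly3) = 0"
    then have "lookup (reduce q (1 :: 'k poly3)) 0 = 0" by simp
    with assms show False by (simp add: lookup_reduce small_def)
  qed
  ultimately have "hilbert_fun (colon_ideal (frobenius_ci q) (1 :: 'k poly3)) i = card ?U"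
    using hilbert_fun_colon[OF _ U(1,3)] by blast
  moreover have "small q \<inter> {m. int (mdeg m) = i} = {m \<in> small q. int (mdeg m) = i}"
    by auto
  ultimately show ?thesis
    using U(2) card_small_mdeg[of q i] by (simp add: colon_ideal_def)
qed

text \<open>For a monomial \<open>n\<close> of \<open>f\<close>, the complementary monomial \<open>(xyz)\<^bsup>q-1\<^esup>/n\<close> is a nonzero element
  of the socle of \<open>P/(c : f)\<close>, which fixes its degree.\<close>
lemma socle_degree_colon:
  fixes f :: "('k::field) poly3"
  assumes f: "f \<in> forms (int d)" "f \<noteq> 0" and "d < q"
    and s: "socle_degree (colon_ideal (frobenius_ci q) f) s"
  shows "s = 3 * (int q - 1) - int d"
proof (rule ccontr)
  assume neq: "s \<noteq> 3 * (int q - 1) - int d"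
  let ?J = "colon_ideal (frobenius_ci q) f"
  have J: "ideal ?J P3"
    by (rule ideal_colon[OF ideal_frobenius_ci])
  \<comment> \<open>The monomial (xyz)^(q-1), the one of highest degree outside c.\<close>
  define top where "top = monom3 (q - 1) (q - 1) (q - 1)"
  have top: "top \<in> small q" "int (mdeg top) = 3 * (int q - 1)"
    using \<open>d < q\<close> by (auto simp: top_def small_iff mdeg_eq of_nat_diff)
  obtain n where n: "n \<in> keys f"
    using f(2) by fastforce
  then have "mdeg n = d"
    using f(1) by (auto simp: forms_def)
  then have le: "lookup n VX \<le> q - 1" "lookup n VY \<le> q - 1" "lookup n VZ \<le> q - 1"
    using \<open>d < q\<close> by (simp_all add: mdeg_eq)
  define m where "m = monom3 (q - 1 - lookup n VX) (q - 1 - lookup n VY) (q - 1 - lookup n VZ)"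
  have mn: "m + n = top"
  proof (rule poly_mapping_eqI)
    fix v show "lookup (m + n) v = lookup top v"
      using le by (cases v) (simp_all add: m_def top_def lookup_add)
  qed
  define x :: "'k poly3" where "x = Poly_Mapping.single m 1"
  have x_forms: "x \<in> forms (int (mdeg m))"
    by (simp add: x_def forms_def)
  have "mdeg m + d = mdeg top"
    unfolding mn[symmetric] mdeg_add \<open>mdeg n = d\<close> ..
  then have xf: "x * f \<in> forms (3 * (int q - 1))"
    using forms_mult[OF x_forms f(1)] top(2) by (metis of_nat_add)
  have "coset3 ?J x \<in> quot_socle ?J"
    unfolding quot_socle_def
  proof (intro CollectI conjI ballI)
    interpret ring_hom_ring P3 "P3 Quot ?J" "coset3 ?J"
      by (rule ring_hom_ring_coset3[OF J])
    show "coset3 ?J x \<in> carrier (P3 Quot ?J)" by simp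
    fix g :: "'k poly3" assume g: "g \<in> irrelevant_ideal"
    have "reduce q (g * (x * f)) = 0"
    proof (rule poly_mapping_eqI)
      fix k
      \<comment> \<open>Every monomial of \<open>g\<close> has positive degree, so the product
        exceeds the degree \<open>3 * (q - 1)\<close> of \<open>top\<close>, beyond which all
        monomials lie in c.\<close>
      have "k \<notin> small q" if k: "k \<in> keys (g * (x * f))"
      proof -
        obtain a b where ab: "k = a + b" "a \<in> keys g" "b \<in> keys (x * f)"
          using k keys_mult[of g "x * f"] by blast
        have "a \<noteq> 0"
          using ab(2) lookup_irrelevant_ideal[OF g] by (auto simp: in_keys_iff)
        have "mdeg a \<noteq> 0"
        proof
          assume "mdeg a = 0"
          then have "a = monom3 0 0 0"
            using monom3_lookup[of a] by (simp add: mdeg_eq)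
          then show False
            using \<open>a \<noteq> 0\<close> by (simp add: monom3_def)
        qed
        moreover have "int (mdeg b) = 3 * (int q - 1)"
          using xf ab(3) by (auto simp: forms_def)
        ultimately show ?thesis
          using mdeg_small[of k q] unfolding ab(1) mdeg_add by fastforce
      qed
      then show "lookup (reduce q (g * (x * f))) k = lookup 0 k"
        by (auto simp: lookup_reduce in_keys_iff)
    qed
    then have "g * x \<in> ?J"
      by (simp add: mem_colon_frobenius_iff mult.assoc)
    then show "coset3 ?J g \<otimes>\<^bsub>P3 Quot ?J\<^esub> coset3 ?J x = \<zero>\<^bsub>P3 Quot ?J\<^esub>"
      using coset3_eq_zero_iff[OF J, of "g * x"] hom_mult[of g x] by simp
  qed
  \<comment> \<open>In the quotient \<open>x\<close> equals some form \<open>g\<close> of degree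
    \<open>s\<close>. The coefficient at \<open>top\<close> then gives a contradiction: it is
    nonzero in \<open>x * f\<close>, but zero in \<open>g * f\<close>, whose degree
    \<open>s + d\<close> differs from that of \<open>top\<close>.\<close>
  then obtain g where g: "g \<in> forms s" "coset3 ?J x = coset3 ?J g"
    using s unfolding socle_degree_def graded_piece_def by blast
  then have "reduce q (x * f) = reduce q (g * f)"
    unfolding coset3_eq_iff[OF J] mem_colon_frobenius_iff
    by (simp add: left_diff_distrib reduce_minus)
  then have "lookup (reduce q (x * f)) top = lookup (reduce q (g * f)) top"
    by simp
  then have "lookup (x * f) top = lookup (g * f) top"
    using top(1) by (simp add: lookup_reduce)
  moreover have "lookup (x * f) top = lookup f n"
    unfolding x_def mn[symmetric] lookup_single_mult by simp
  moreover have "top \<notin> keys (g * f)"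
    using forms_mult[OF g(1) f(1)] top(2) neq by (auto simp: forms_def)
  ultimately show False
    using n by (simp add: in_keys_iff)
qed

text \<open>A linear relation splits into its homogeneous components, each of which is trivial. The
  shift \<open>e\<close> allows for the degree that multiplication by \<open>f\<close> adds.\<close>

lemma independent_UN_forms:
  fixes B :: "int \<Rightarrow> ('k::field) poly3 set"
  assumes "finite I" and B: "\<And>i. i \<in> I \<Longrightarrow> finite (B i)" "\<And>i. i \<in> I \<Longrightarrow> V3.independent (B i)"
    "\<And>i. i \<in> I \<Longrightarrow> B i \<subseteq> forms (i + e)"
  shows "V3.independent (\<Union>i\<in>I. B i)" and "card (\<Union>i\<in>I. B i) = (\<Sum>i\<in>I. card (B i))"
proof -
  have disj: "B i \<inter> B j = {}" if "i \<in> I" "j \<in> I" "i \<noteq> j" for i j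
  proof -
    have "x = 0" if "x \<in> B i \<inter> B j" for x
    proof -
      have "x \<in> forms (i + e)" "x \<in> forms (j + e)"
        using that B(3) \<open>i \<in> I\<close> \<open>j \<in> I\<close> by blast+
      then have "keys x = {}"
        using \<open>i \<noteq> j\<close> by (fastforce simp: forms_def)
      then show "x = 0" by simp
    qed
    \<comment> \<open>A common element of two degrees is 0, which an independent set does not
      contain.\<close>
    moreover have "0 \<notin> B i"
      using B(2)[OF \<open>i \<in> I\<close>] V3.dependent_zero by blast
    ultimately show ?thesis by blast
  qed
  show "card (\<Union>i\<in>I. B i) = (\<Sum>i\<in>I. card (B i))"
    using disj B(1) \<open>finite I\<close> by (intro card_UN_disjoint) auto
  have fin: "finite (\<Union>i\<in>I. B i)"
    using \<open>finite I\<close> B(1) by blast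
  show "V3.independent (\<Union>i\<in>I. B i)"
  proof (rule V3.independent_if_scalars_zero[OF fin])
    fix u x
    assume "(\<Sum>y\<in>(\<Union>i\<in>I. B i). Const3 (u y) * y) = 0" and "x \<in> (\<Union>i\<in>I. B i)"
    then obtain j where j: "j \<in> I" "x \<in> B j" by blast
    let ?S = "\<lambda>i. \<Sum>y\<in>B i. Const3 (u y) * y"
    have S: "?S i \<in> forms (i + e)" if "i \<in> I" for i
      using B(3)[OF that] V3.subspace_scale[OF subspace_forms]
      by (intro V3.subspace_sum[OF subspace_forms]) blast
    have sum0: "(\<Sum>i\<in>I. ?S i) = 0"
      using \<open>(\<Sum>y\<in>(\<Union>i\<in>I. B i). Const3 (u y) * y) = 0\<close> disj B(1) \<open>finite I\<close>
      by (subst (asm) sum.UNION_disjoint) auto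
    have "?S j = 0"
    proof (rule poly_mapping_eqI)
      fix m
      show "lookup (?S j) m = lookup 0 m"
      proof (cases "int (mdeg m) = j + e")
        case True
        have "lookup (?S i) m = 0" if "i \<in> I" "i \<noteq> j" for i
          using S[OF that(1)] that(2) True by (auto simp: forms_def in_keys_iff)
        then have "(\<Sum>i\<in>I. lookup (?S i) m) = lookup (?S j) m"
          using \<open>finite I\<close> j(1) by (subst sum.remove[OF _ j(1)]) (auto intro!: sum.neutral)
        moreover have "(\<Sum>i\<in>I. lookup (?S i) m) = 0"
          unfolding lookup_sum[symmetric] sum0 by simp
        ultimately show ?thesis by simp
      next
        case False
        then show ?thesis
          using S[OF j(1)] by (auto simp: forms_def in_keys_iff)
      qed
    qed
    then show "u x = 0"
      by (rule V3.independentD[OF B(2) B(1) subset_refl _ j(2), OF j(1) j(1)])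
  qed
qed

text \<open>Finiteness comes from the finite-dimensional span of the small monomials, which contains
  all reduced polynomials.\<close>

lemma obtain_reduce_mult_basis:
  fixes f :: "('k::field) poly3"
  assumes "V3.subspace V"
  obtains B where "finite B" "V3.independent B" "V3.span B = (\<lambda>g. reduce q (g * f)) ` V"
proof -
  let ?V = "(\<lambda>g. reduce q (g * f)) ` V"
  note W = small_monoms[where 'k = 'k and q = q and M = UNIV]
  obtain B where B: "B \<subseteq> ?V" "V3.independent B" "?V \<subseteq> V3.span B"
    by (rule V3.maximal_independent_subset)
  have "B \<subseteq> V3.span (small_monoms q UNIV)"
    using B(1) unfolding W(4) by (auto simp: in_keys_iff lookup_reduce split: if_splits)
  then have "finite B"
    using V3.independent_span_bound[OF W(1) B(2)] by blast
  moreover have "V3.span B = ?V"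
    by (rule V3.span_subspace[OF B(1,3) subspace_reduce_mult[OF assms]])
  ultimately show thesis
    using that B(2) by blast
qed

theorem theorem5p11:
  fixes f :: "('k::field) poly3" and p d q e :: nat
  assumes "CHAR('k) = p" and "p > 0"
    and "f \<noteq> 0" and "f \<in> forms (int d)"
    and "f \<in> irrelevant_ideal \<cdot>\<^bsub>P3\<^esub> irrelevant_ideal"
    and "even p \<noteq> even d"
    and "q = p ^ e" and "q \<ge> d + 3"
    and "link_compressed q f"
  shows "real (HK f q) = 3 / 4 * real d * real q ^ 2 - 1 / 12 * (real d ^ 3 - real d)"
proof -
  let ?J = "colon_ideal (frobenius_ci q) f"
  let ?T = "\<lambda>g. reduce q (g * f)"
  have "q > 0" "d < q"
    using assms(8) by linarith+
  obtain s where s: "socle_degree ?J s"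
    and hilbert: "\<And>i. hilbert_fun ?J i = min (hilbert_fun (frobenius_ci q :: 'k poly3 set) i)
        (hilbert_fun (frobenius_ci q :: 'k poly3 set) (s - i))"
    using assms(9) unfolding link_compressed_def compressed_def by blast
  have s_eq: "s = 3 * (int q - 1) - int d"
    by (rule socle_degree_colon[OF assms(4,3) \<open>d < q\<close> s])
  \<comment> \<open>Since \<open>q \<ge> 3\<close>, the power is not the trivial one, so
    \<open>q\<close> has the parity of \<open>p\<close>.\<close>
  have "e \<noteq> 0"
    using assms(7,8) by (cases e) auto
  then have "even q \<noteq> even d"
    using assms(6,7) by simp
  then have "even s"
    unfolding s_eq by auto
  moreover have "s \<ge> 0"
    using \<open>d < q\<close> unfolding s_eq by simp
  ultimately obtain t where t: "s = 2 * int t"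
    by (metis evenE nonneg_int_cases zero_le_mult_iff zero_less_numeral not_less)
  \<comment> \<open>All monomials of \<open>f\<close> have degree \<open>d < q\<close> and hence
    survive reduction.\<close>
  have red_f: "reduce q f \<noteq> 0"
  proof
    assume "reduce q f = 0"
    obtain n where n: "n \<in> keys f"
      using assms(3) by fastforce
    then have "mdeg n = d"
      using assms(4) by (auto simp: forms_def)
    then have "n \<in> small q"
      using \<open>d < q\<close> by (simp add: small_iff mdeg_eq)
    then have "lookup (reduce q f) n \<noteq> 0"
      using n by (simp add: lookup_reduce in_keys_iff)
    then show False
      using \<open>reduce q f = 0\<close> by simp
  qed
  have "\<forall>i. \<exists>B. finite B \<and> V3.independent B \<and> V3.span B = ?T ` forms i"
    using obtain_reduce_mult_basis[OF subspace_forms] by metis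
  then obtain B where B: "\<And>i. finite (B i)" "\<And>i. V3.independent (B i)"
    "\<And>i. V3.span (B i) = ?T ` forms i"
    by metis
  have card_B: "int (card (B i)) = min (triples_count q i) (triples_count q (s - i))" for i
  proof -
    have "card (B i) = hilbert_fun ?J i"
      using hilbert_fun_colon[OF red_f B(1-3)] by simp
    then show ?thesis
      unfolding hilbert hilbert_fun_frobenius_ci[OF \<open>q > 0\<close>, where 'k = 'k, symmetric]
      by simp
  qed
  have B_forms: "B i \<subseteq> forms (i + int d)" for i
  proof -
    have "B i \<subseteq> ?T ` forms i"
      using V3.span_superset[of "B i"] unfolding B(3) .
    then show ?thesis
      using reduce_forms[OF forms_mult[OF _ assms(4)]] by blast
  qed
  \<comment> \<open>The images of the graded pieces of degree 0 to \<open>s\<close> together give a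
    basis of the whole image of fP in P/c.\<close>
  let ?B = "\<Union>i\<in>{0..s}. B i"
  have "V3.span ?B = range ?T"
  proof (rule V3.span_subspace)
    have "B i \<subseteq> range ?T" for i
      using V3.span_superset[of "B i"] unfolding B(3) by blast
    then show "?B \<subseteq> range ?T" by blast
    show "V3.subspace (range ?T)"
      by (rule subspace_reduce_mult[OF V3.subspace_UNIV])
    show "range ?T \<subseteq> V3.span ?B"
    proof (rule image_subsetI)
      fix g :: "'k poly3"
      have T1: "?T (Poly_Mapping.single m 1) \<in> V3.span ?B" for m
      proof -
        let ?i = "int (mdeg m)"
        have "?T (Poly_Mapping.single m 1) \<in> V3.span (B ?i)"
          unfolding B(3) by (rule imageI) (simp add: forms_def)
        \<comment> \<open>Beyond degree \<open>s\<close> the bases are empty, because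
          \<open>triples_count\<close> vanishes at the negative argument
          \<open>s - ?i\<close>.\<close>
        moreover have "B ?i \<subseteq> ?B"
        proof (cases "?i \<le> s")
          case False
          then have "triples_count q (s - ?i) = 0"
            by (simp add: triples_count_eq_0)
          then have "card (B ?i) = 0"
            using card_B[of ?i] by linarith
          then show ?thesis using B(1) by simp
        next
          case True
          then show ?thesis by (intro UN_upper) simp
        qed
        ultimately show ?thesis
          using V3.span_mono by blast
      qed
      have "?T (Const3 (lookup g m) * Poly_Mapping.single m 1) \<in> V3.span ?B" for m
        unfolding mult.assoc reduce_Const3_mult by (rule V3.span_scale[OF T1])
      then have T: "?T (Poly_Mapping.single m (lookup g m)) \<in> V3.span ?B" for m
        by simp
      have "?T (\<Sum>m\<in>A. Poly_Mapping.single m (lookup g m)) \<in> V3.span ?B" for A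
      proof (induction A rule: infinite_finite_induct)
        case (insert m A)
        then show ?case
          using V3.span_add[OF T[of m] insert.IH] by (simp add: distrib_right reduce_add)
      qed (simp_all add: reduce_def V3.span_zero)
      from this[of "keys g"] show "?T g \<in> V3.span ?B"
        by (simp add: sum_single_lookup)
    qed
  qed
  moreover have "finite ?B"
    using B(1) by blast
  moreover have "lookup f 0 = 0"
  proof -
    have I: "ideal (irrelevant_ideal :: 'k poly3 set) P3"
      unfolding irrelevant_ideal_def by (rule P3.genideal_ideal) simp
    show ?thesis
      using assms(5) P3.ideal_prod_inter[OF I I] lookup_irrelevant_ideal by blast
  qed
  ultimately have "HK f q + card ?B = q ^ 3"
    using HK_add_card[OF _ \<open>q > 0\<close>] independent_UN_forms(1)[OF _ B(1,2) B_forms] by blast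
  moreover have "card ?B = (\<Sum>i\<in>{0..s}. card (B i))"
    by (rule independent_UN_forms(2)[OF _ B(1,2) B_forms]) simp
  ultimately have "int (HK f q)
      = int q ^ 3 - (\<Sum>i\<in>{0..s}. min (triples_count q i) (triples_count q (s - i)))"
    by (simp flip: card_B of_nat_sum of_nat_power)
  \<comment> \<open>Multiplying by 12 keeps the identity in the integers; it is divided out only
    after passing to the reals.\<close>
  then have "12 * int (HK f q) = 9 * int d * int q ^ 2 - (int d ^ 3 - int d)"
    using sum_min_triples_count[of q t d] assms(8) s_eq unfolding t by simp
  then have "real_of_int (12 * int (HK f q))
      = real_of_int (9 * int d * int q ^ 2 - (int d ^ 3 - int d))"
    by simp
  then show ?thesis
    by (simp add: field_simps)
qed

end
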